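(* Let $\beta_3 \in S_n$ be a $3$-cycle. Then \begin{enumerate} \item $c(0, \beta_3)=3(n-3)!$ for $n\geq 3$; \item $c(3, \beta_3)=(3(n-3)+1)\cdot 3(n-3)!$ for $n\geq 3$; \item $c(4, \beta_3)=3(n-3)\cdot 3(n-3)!$ for $n\geq 4$; \item $c(5, \beta_3)=6\binom{n-3}{2}\cdot 3(n-3)!$ for $n\geq 5$; \item $c(6, \beta_3)=2\binom{n-3}{3}\cdot 3(n-3)!$ for $n\geq 6$; \item $c(k, \beta_3)=0$ for every integer $k$ with $7 \leq k \leq n$. \end{enumerate}
   Context: $S_n$ is the group of permutations of $[n]=\{1,\dots,n\}$; products are composed right to left. The Hamming distance between $\sigma,\tau\in S_n$ is $H(\sigma,\tau)=|\{a\in[n]:\sigma(a)\neq\tau(a)\}|$. Two permutations $\alpha,\beta\in S_n$ $k$-commute if $H(\alpha\beta,\beta\alpha)=k$. For $\beta\in S_n$ and a nonnegative integer $k$, $c(k,\beta)$ denotes the number of $\alpha\in S_n$ that $k$-commute with $\beta$. A $3$-cycle in $S_n$ is a permutation whose disjoint cycle factorization consists of one cycle of length $3$ and $n-3$ fixed points. *)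

theory Defs
  imports "HOL-Algebra.Sym_Groups"
begin

text \<open>Permutations of \<open>{1..n}\<close> are functions on all of \<^typ>\<open>nat\<close> that fix every point outside
  \<open>{1..n}\<close> (\<^const>\<open>permutes\<close>), so the degree \<open>n\<close> is passed explicitly.\<close>

definition hamming_dist :: "nat \<Rightarrow> (nat \<Rightarrow> nat) \<Rightarrow> (nat \<Rightarrow> nat) \<Rightarrow> nat" where
  "hamming_dist n \<sigma> \<tau> = card {a \<in> {1..n}. \<sigma> a \<noteq> \<tau> a}"

definition k_commute :: "nat \<Rightarrow> nat \<Rightarrow> (nat \<Rightarrow> nat) \<Rightarrow> (nat \<Rightarrow> nat) \<Rightarrow> bool" where
  "k_commute n k \<alpha> \<beta> \<longleftrightarrow> hamming_dist n (\<alpha> \<circ> \<beta>) (\<beta> \<circ> \<alpha>) = k"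

definition c :: "nat \<Rightarrow> nat \<Rightarrow> (nat \<Rightarrow> nat) \<Rightarrow> nat" where
  "c n k \<beta> = card {\<alpha>. \<alpha> permutes {1..n} \<and> k_commute n k \<alpha> \<beta>}"

end

theory Submission
  imports Defs
begin

text \<open>Substituting \<open>b = \<alpha> a\<close> shows that \<open>\<alpha>\<close> \<open>k\<close>-commutes with \<open>\<beta>\<close> iff the conjugate
  \<open>\<alpha> \<beta> \<alpha>\<^sup>-\<^sup>1\<close> differs from \<open>\<beta>\<close> in exactly \<open>k\<close> points. For \<open>\<beta> = (x y z)\<close> the conjugate is the
  cycle \<open>(\<alpha> x \<alpha> y \<alpha> z)\<close>, and each triple of distinct values is attained by \<open>(n - 3)!\<close> permutations
  \<open>\<alpha>\<close>. It remains to count, up to rotation, the 3-cycles at distance \<open>k\<close> from \<open>\<beta>\<close>: \<open>\<beta>\<close> itself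
  (distance 0), its inverse (3), those meeting \<open>{x, y, z}\<close> in two points and traversing the common
  arc of \<open>\<beta>\<close> forwards (3) or backwards (4), those meeting it in one point (5), and those
  disjoint from it (6).\<close>

section \<open>Permutations with prescribed values on a list\<close>

text \<open>The complements of \<open>set xs\<close> and \<open>set ys\<close> in \<open>S\<close>
  have equal size, so a bijection between them can be glued to the positional matching of
  \<open>xs\<close> with \<open>ys\<close>.\<close>

lemma exists_permutes_map_eq:
  assumes "finite S" "distinct xs" "distinct ys" "length xs = length ys"
    and "set xs \<subseteq> S" "set ys \<subseteq> S"
  shows "\<exists>p. p permutes S \<and> map p xs = ys"
proof -
  have "card (S - set xs) = card (S - set ys)"
    using assms by (simp add: card_Diff_subset distinct_card)
  then obtain g where g: "bij_betw g (S - set xs) (S - set ys)"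
    using assms(1) finite_same_card_bij by blast
  \<comment> \<open>Off \<open>set xs\<close> the value of \<open>h\<close> is unspecified;
    \<open>p\<close> below consults it only on \<open>set xs\<close>.\<close>
  define h where "h = (\<lambda>x. the (map_of (zip xs ys) x))"
  have map_h: "map h xs = ys"
    using assms(2,4) by (auto intro!: nth_equalityI simp: h_def map_of_zip_nth)
  have h: "bij_betw h (set xs) (set ys)"
    using assms(2,3) map_h by (metis bij_betw_def distinct_map list.set_map)
  define p where "p = (\<lambda>x. if x \<in> set xs then h x else if x \<in> S then g x else x)"
  have "bij_betw p (set xs) (set ys)" "bij_betw p (S - set xs) (S - set ys)"
    using h g bij_betw_cong[of "set xs" p h] bij_betw_cong[of "S - set xs" p g]
    by (simp_all add: p_def)
  then have "bij_betw p (set xs \<union> (S - set xs)) (set ys \<union> (S - set ys))"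
    by (rule bij_betw_combine) auto
  then have "bij_betw p S S"
    using assms(5,6) by (simp add: Un_absorb1)
  then have "p permutes S"
    using assms(5) by (intro bij_imp_permutes) (auto simp: p_def)
  moreover have "map p xs = ys"
    using map_h by (auto simp: p_def cong: map_cong)
  ultimately show ?thesis by blast
qed

text \<open>The solutions form a left coset: one solution \<open>g\<close> composed with the
  pointwise stabiliser of \<open>set xs\<close>, which is the symmetric group on
  \<open>S - set xs\<close>.\<close>

lemma card_permutes_map_eq:
  assumes "finite S" "distinct xs" "distinct ys" "length xs = length ys"
    and "set xs \<subseteq> S" "set ys \<subseteq> S"
  shows "card {p. p permutes S \<and> map p xs = ys} = fact (card S - length xs)"
proof -
  obtain g where g: "g permutes S" "map g xs = ys"
    using exists_permutes_map_eq[OF assms] by blast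
  have eq: "{p. p permutes S \<and> map p xs = ys} = (\<lambda>q. g \<circ> q) ` {q. q permutes S - set xs}"
  proof (intro Set.set_eqI iffI)
    fix p assume "p \<in> {p. p permutes S \<and> map p xs = ys}"
    then have p: "p permutes S" "map p xs = map g xs"
      using g(2) by auto
    have "inv' g \<circ> p permutes S"
      using p(1) g(1) by (intro permutes_compose permutes_inv)
    moreover have "(inv' g \<circ> p) x = x" if "x \<in> set xs" for x
      using p(2) that permutes_inverses(2)[OF g(1)] by simp
    ultimately have "inv' g \<circ> p permutes S - set xs"
      by (rule permutes_superset) auto
    moreover have "p = g \<circ> (inv' g \<circ> p)"
      using permutes_inverses(1)[OF g(1)] by (auto simp: fun_eq_iff)
    ultimately show "p \<in> (\<lambda>q. g \<circ> q) ` {q. q permutes S - set xs}" by blast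
  next
    fix p assume "p \<in> (\<lambda>q. g \<circ> q) ` {q. q permutes S - set xs}"
    then obtain q where q: "q permutes S - set xs" "p = g \<circ> q" by blast
    have "q permutes S" using q(1) by (rule permutes_subset) auto
    moreover have "map q xs = xs"
      using q(1) by (auto intro!: map_idI simp: permutes_def)
    ultimately show "p \<in> {p. p permutes S \<and> map p xs = ys}"
      using g q(2) by (auto intro: permutes_compose simp flip: map_map)
  qed
  have "inj_on (\<lambda>q. g \<circ> q) {q. q permutes S - set xs}"
    using permutes_inj[OF g(1)] by (auto simp: inj_on_def fun_eq_iff)
  then show ?thesis
    unfolding eq using assms
    by (simp add: card_image card_permutations card_Diff_subset distinct_card)
qed

section \<open>Counting lists of distinct elements\<close>

definition arrangements :: "'a set \<Rightarrow> nat \<Rightarrow> 'a list set" where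
  "arrangements A k = {xs. length xs = k \<and> distinct xs \<and> set xs \<subseteq> A}"

lemma finite_arrangements [simp]: "finite A \<Longrightarrow> finite (arrangements A k)"
  by (rule finite_subset[OF _ finite_lists_length_eq[of A k]]) (auto simp: arrangements_def)

text \<open>The binomial form stays valid for \<open>k > card A\<close>, where both sides are 0, so
  small \<open>n\<close> needs no separate treatment later.\<close>

lemma card_arrangements:
  assumes "finite A"
  shows "card (arrangements A k) = fact k * (card A choose k)"
proof (cases "k \<le> card A")
  case True
  \<comment> \<open>The library count is the falling factorial, a product over
    \<open>{card A - k + 1..card A}\<close>; splitting \<open>fact (card A)\<close> turns it into
    the binomial form.\<close>
  have "fact (card A) = \<Prod>{1..card A}" by (simp add: fact_prod)
  also have "{1..card A} = {1..card A - k} \<union> {card A - k + 1..card A}" by auto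
  also have "\<Prod>\<dots> = fact (card A - k) * \<Prod>{card A - k + 1..card A}"
    by (subst prod.union_disjoint) (auto simp: fact_prod)
  finally have "\<Prod>{card A - k + 1..card A} = fact k * (card A choose k)"
    using binomial_fact_lemma[OF True] by (simp add: ac_simps)
  then show ?thesis
    using card_lists_distinct_length_eq[OF assms True] by (simp add: arrangements_def)
next
  case False
  have "k \<le> card A" if "xs \<in> arrangements A k" for xs
    using that card_mono[OF assms, of "set xs"] distinct_card[of xs]
    by (auto simp: arrangements_def)
  with False have "arrangements A k = {}" by blast
  then show ?thesis using False by (simp add: binomial_eq_0)
qed

lemma arrangements_2: "ws \<in> arrangements A 2 \<longleftrightarrow> (\<exists>v w. ws = [v, w] \<and> v \<noteq> w \<and> v \<in> A \<and> w \<in> A)"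
  by (auto simp: arrangements_def numeral_2_eq_2 length_Suc_conv)

lemma arrangements_3: "ws \<in> arrangements A 3 \<longleftrightarrow>
    (\<exists>u v w. ws = [u, v, w] \<and> distinct [u, v, w] \<and> u \<in> A \<and> v \<in> A \<and> w \<in> A)"
  by (auto simp: arrangements_def numeral_3_eq_3 length_Suc_conv)

section \<open>From commuting permutations to lists of cycle entries\<close>

text \<open>The permutation \<open>p\<close> itself is a bijection between the two sets of
  disagreement.\<close>

lemma hamming_dist_conjugate:
  assumes "p permutes {1..n}"
  shows "hamming_dist n (p \<circ> f) (f \<circ> p) = hamming_dist n (p \<circ> f \<circ> inv' p) f"
proof -
  have "bij_betw p {a \<in> {1..n}. (p \<circ> f) a \<noteq> (f \<circ> p) a}
      {b \<in> {1..n}. (p \<circ> f \<circ> inv' p) b \<noteq> f b}"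
  proof (rule bij_betw_byWitness[where f' = "inv' p"])
    show "inv' p ` {b \<in> {1..n}. (p \<circ> f \<circ> inv' p) b \<noteq> f b} \<subseteq> {a \<in> {1..n}. (p \<circ> f) a \<noteq> (f \<circ> p) a}"
      using permutes_in_image[OF permutes_inv[OF assms]] permutes_inverses[OF assms] by auto
  qed (use permutes_in_image[OF assms] permutes_inverses[OF assms] in auto)
  then show ?thesis
    unfolding hamming_dist_def by (rule bij_betw_same_card)
qed

text \<open>Conjugation by \<open>p\<close> sends the cycle of \<open>cs\<close> to the cycle of
  \<open>map p cs\<close>, so the permutations are grouped by the fibres of \<open>p\<close> under
  \<open>map p cs\<close>, each of size \<open>fact (n - l)\<close>. Lists are counted here, not
  cycles: a 3-cycle appears once for each of its three rotations.\<close>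

lemma c_cycle:
  assumes "cs \<in> arrangements {1..n} l"
  shows "c n k (cycle_of_list cs) = card {ts \<in> arrangements {1..n} l.
    hamming_dist n (cycle_of_list ts) (cycle_of_list cs) = k} * fact (n - l)"
proof -
  let ?T = "{ts \<in> arrangements {1..n} l. hamming_dist n (cycle_of_list ts) (cycle_of_list cs) = k}"
  have cs: "distinct cs" "length cs = l" "set cs \<subseteq> {1..n}"
    using assms by (auto simp: arrangements_def)
  have "k_commute n k p (cycle_of_list cs) \<longleftrightarrow> map p cs \<in> ?T" if p: "p permutes {1..n}" for p
  proof -
    have "map p cs \<in> arrangements {1..n} l"
      using cs p permutes_in_image[OF p] permutes_inj_on[OF p]
      by (auto simp: arrangements_def distinct_map)
    then show ?thesis
      by (simp add: k_commute_def hamming_dist_conjugate[OF p]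
        conjugation_of_cycle[OF cs(1) permutes_bij[OF p]])
  qed
  then have "{p. p permutes {1..n} \<and> k_commute n k p (cycle_of_list cs)}
      = (\<Union>ts\<in>?T. {p. p permutes {1..n} \<and> map p cs = ts})"
    by auto
  then have "c n k (cycle_of_list cs) = (\<Sum>ts\<in>?T. card {p. p permutes {1..n} \<and> map p cs = ts})"
    unfolding c_def
    by (simp only:) (rule card_UN_disjoint, auto intro: finite_subset[OF _ finite_permutations])
  also have "\<dots> = (\<Sum>ts\<in>?T. fact (n - l))"
    using cs by (intro sum.cong) (auto simp: arrangements_def card_permutes_map_eq)
  finally show ?thesis by simp
qed

text \<open>Both cycles fix every point outside \<open>set bs\<close>, so the distance can be
  evaluated along an explicit list.\<close>

lemma hamming_dist_cycles:
  assumes "distinct bs" "set bs \<subseteq> {1..n}" "set ts \<union> set cs \<subseteq> set bs"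
  shows "hamming_dist n (cycle_of_list ts) (cycle_of_list cs)
    = length (filter (\<lambda>b. cycle_of_list ts b \<noteq> cycle_of_list cs b) bs)"
proof -
  have "{b \<in> {1..n}. cycle_of_list ts b \<noteq> cycle_of_list cs b}
      = set (filter (\<lambda>b. cycle_of_list ts b \<noteq> cycle_of_list cs b) bs)"
    using assms(2,3) by auto (metis id_outside_supp subsetD)
  then show ?thesis
    unfolding hamming_dist_def using assms(1) by (simp only: distinct_card distinct_filter)
qed

section \<open>Closure of a set of lists under rotation\<close>

text \<open>Rotations are invertible by rotations, so this preimage form also gives all rotations of
  members of \<open>A\<close>. It allows \<open>A\<close> to hold a single representative list per
  cycle.\<close>

definition rotations :: "'a list set \<Rightarrow> 'a list set" where
  "rotations A = {ts. \<exists>i. rotate i ts \<in> A}"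

lemma rotate_three_cases:
  "rotate i [p, q, r] \<in> {[p, q, r], [q, r, p], [r, p, q]}"
proof -
  have "rotate i [p, q, r] = rotate (i mod 3) [p, q, r]"
    by (subst rotate_conv_mod) simp
  moreover consider "i mod 3 = 0" | "i mod 3 = 1" | "i mod 3 = 2" by linarith
  then have "rotate (i mod 3) [p, q, r] \<in> {[p, q, r], [q, r, p], [r, p, q]}"
    by cases (simp_all add: numeral_2_eq_2)
  ultimately show ?thesis by metis
qed

lemma rotations_three_iff:
  "[p, q, r] \<in> rotations A \<longleftrightarrow> [p, q, r] \<in> A \<or> [q, r, p] \<in> A \<or> [r, p, q] \<in> A"
proof
  assume "[p, q, r] \<in> rotations A"
  then obtain i where "rotate i [p, q, r] \<in> A"
    by (auto simp: rotations_def)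
  then show "[p, q, r] \<in> A \<or> [q, r, p] \<in> A \<or> [r, p, q] \<in> A"
    using rotate_three_cases[of i p q r] by (elim insertE emptyE) simp_all
next
  have "rotate 0 [p, q, r] = [p, q, r]" "rotate 1 [p, q, r] = [q, r, p]"
    "rotate 2 [p, q, r] = [r, p, q]"
    by (simp_all add: numeral_2_eq_2)
  then show "[p, q, r] \<in> A \<or> [q, r, p] \<in> A \<or> [r, p, q] \<in> A \<Longrightarrow> [p, q, r] \<in> rotations A"
    unfolding rotations_def by (elim disjE) (metis CollectI)+
qed

lemma rotations_subset:
  assumes "A \<subseteq> arrangements S k"
  shows "rotations A \<subseteq> arrangements S k"
proof
  fix ts assume "ts \<in> rotations A"
  then obtain i where "rotate i ts \<in> arrangements S k"
    using assms by (auto simp: rotations_def)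
  then show "ts \<in> arrangements S k"
    by (simp add: arrangements_def)
qed

text \<open>The set is the union of \<open>A\<close> and its two rotated copies. Rotating by two
  places undoes rotating by one, so \<open>no_rot\<close> makes all three pairwise disjoint.\<close>

lemma card_rotations:
  assumes "finite S" and A: "A \<subseteq> arrangements S 3"
    and no_rot: "\<And>p q r. [p, q, r] \<in> A \<Longrightarrow> [q, r, p] \<notin> A"
  shows "card (rotations A) = 3 * card A"
proof -
  have finA: "finite A"
    using assms(1) A by (meson finite_arrangements finite_subset)
  have lenA: "length ts = 3" if "ts \<in> A" for ts
    using that A by (auto simp: arrangements_def)
  have three: "\<exists>p q r. ts = [p, q, r]" if "length ts = 3" for ts :: "'a list"
    using that by (auto simp: numeral_3_eq_3 length_Suc_conv)
  have len: "length ts = 3" if "ts \<in> rotations A" for ts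
    using that rotations_subset[OF A] by (auto simp: arrangements_def)
  have rot: "rotate1 [p, q, r] = [q, r, p]" "rotate 2 [p, q, r] = [r, p, q]" for p q r :: 'a
    by (simp_all add: numeral_2_eq_2)
  have inj: "inj_on rotate1 A" "inj_on (rotate 2) A"
    using three[OF lenA] by (auto intro!: inj_onI dest!: three[OF lenA] simp: rot)
  have img1: "[p, q, r] \<in> rotate1 ` A \<longleftrightarrow> [r, p, q] \<in> A" for p q r
  proof
    show "[p, q, r] \<in> rotate1 ` A \<Longrightarrow> [r, p, q] \<in> A"
      using three[OF lenA] rot(1) by (smt (verit) imageE list.inject)
    show "[r, p, q] \<in> A \<Longrightarrow> [p, q, r] \<in> rotate1 ` A"
      using rot(1)[of r p q] image_eqI by metis
  qed
  have img2: "[p, q, r] \<in> rotate 2 ` A \<longleftrightarrow> [q, r, p] \<in> A" for p q r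
  proof
    show "[p, q, r] \<in> rotate 2 ` A \<Longrightarrow> [q, r, p] \<in> A"
      using three[OF lenA] rot(2) by (smt (verit) imageE list.inject)
    show "[q, r, p] \<in> A \<Longrightarrow> [p, q, r] \<in> rotate 2 ` A"
      using rot(2)[of q r p] image_eqI by metis
  qed
  have "ts \<in> rotations A \<longleftrightarrow> ts \<in> A \<union> (rotate1 ` A \<union> rotate 2 ` A)" for ts
  proof (cases "length ts = 3")
    case True
    then obtain p q r where "ts = [p, q, r]" using three by blast
    then show ?thesis by (simp add: rotations_three_iff img1 img2 disj_ac)
  next
    case False
    then have "ts \<notin> rotations A" using len by blast
    moreover have "ts \<notin> A \<union> (rotate1 ` A \<union> rotate 2 ` A)"
      using False lenA by auto
    ultimately show ?thesis by blast
  qed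
  then have "rotations A = A \<union> (rotate1 ` A \<union> rotate 2 ` A)" by blast
  moreover have "A \<inter> (rotate1 ` A \<union> rotate 2 ` A) = {}" "rotate1 ` A \<inter> rotate 2 ` A = {}"
  proof -
    have "us \<noteq> rotate1 vs" "us \<noteq> rotate 2 vs" "rotate1 us \<noteq> rotate 2 vs"
      if "us \<in> A" "vs \<in> A" for us vs
    proof -
      obtain p q r where "us = [p, q, r]" using three lenA \<open>us \<in> A\<close> by blast
      moreover obtain p' q' r' where "vs = [p', q', r']" using three lenA \<open>vs \<in> A\<close> by blast
      ultimately show "us \<noteq> rotate1 vs" "us \<noteq> rotate 2 vs" "rotate1 us \<noteq> rotate 2 vs"
        using that no_rot by (auto simp: rot)
    qed
    then show "A \<inter> (rotate1 ` A \<union> rotate 2 ` A) = {}" "rotate1 ` A \<inter> rotate 2 ` A = {}"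
      by blast+
  qed
  ultimately show ?thesis
    using finA by (simp add: card_Un_disjoint card_image[OF inj(1)] card_image[OF inj(2)])
qed

text \<open>A cycle does not depend on which entry its list starts from, provided the entries are
  distinct; representatives therefore suffice.\<close>

lemma hamming_dist_rotations:
  assumes "ts \<in> rotations A"
    and "\<And>us. us \<in> A \<Longrightarrow> distinct us \<and> hamming_dist n (cycle_of_list us) f = k"
  shows "hamming_dist n (cycle_of_list ts) f = k"
proof -
  obtain i where i: "rotate i ts \<in> A"
    using assms(1) by (auto simp: rotations_def)
  then have "distinct ts" using assms(2) by force
  then show ?thesis
    using assms(2)[OF i] cycle_of_list_rotate_independent by metis
qed

section \<open>Distances between explicit 3-cycles\<close>

text \<open>Replaces the recursive unfolding into transpositions, which is switched off in the
  evaluations below.\<close>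

lemma cycle_of_list_three:
  assumes "distinct [p, q, r]"
  shows "cycle_of_list [p, q, r] b = (if b = p then q else if b = q then r else if b = r then p else b)"
  using assms by (auto simp: transpose_def)

text \<open>A distance free of \<open>n\<close>, so that it can be computed for arbitrary distinct
  points.\<close>

definition moved :: "'a list \<Rightarrow> 'a list \<Rightarrow> 'a list \<Rightarrow> nat" where
  "moved bs ts cs = length (filter (\<lambda>b. cycle_of_list ts b \<noteq> cycle_of_list cs b) bs)"

text \<open>Of the four points only the start of the common arc has the same image under both
  cycles.\<close>

lemma moved_along:
  assumes "distinct [x, y, z, w]"
  shows "moved [x, y, z, w] [x, y, w] [x, y, z] = 3" "moved [x, y, z, w] [y, z, w] [x, y, z] = 3"
    "moved [x, y, z, w] [z, x, w] [x, y, z] = 3"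
  using assms unfolding moved_def by (auto simp: cycle_of_list_three simp del: cycle_of_list.simps)

text \<open>With the arc reversed, no point of the two supports keeps its image.\<close>

lemma moved_against:
  assumes "distinct [x, y, z, w]"
  shows "moved [x, y, z, w] [y, x, w] [x, y, z] = 4" "moved [x, y, z, w] [z, y, w] [x, y, z] = 4"
    "moved [x, y, z, w] [x, z, w] [x, y, z] = 4"
  using assms unfolding moved_def by (auto simp: cycle_of_list_three simp del: cycle_of_list.simps)

lemma moved_meeting:
  assumes "distinct [x, y, z, v, w]"
  shows "moved [x, y, z, v, w] [x, v, w] [x, y, z] = 5" "moved [x, y, z, v, w] [y, v, w] [x, y, z] = 5"
    "moved [x, y, z, v, w] [z, v, w] [x, y, z] = 5"
  using assms unfolding moved_def by (auto simp: cycle_of_list_three simp del: cycle_of_list.simps)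

lemma moved_disjoint:
  assumes "distinct [x, y, z, u, v, w]"
  shows "moved [x, y, z, u, v, w] [u, v, w] [x, y, z] = 6"
  using assms unfolding moved_def by (auto simp: cycle_of_list_three simp del: cycle_of_list.simps)

section \<open>Classification of 3-cycles relative to a fixed one\<close>

locale three_cycle =
  fixes n x y z :: nat
  assumes arr: "[x, y, z] \<in> arrangements {1..n} 3"
begin

definition outside :: "nat set" where "outside = {1..n} - {x, y, z}"

text \<open>The graph of the cycle \<open>(x y z)\<close> on its support.\<close>

definition arcs :: "(nat \<times> nat) set" where "arcs = {(x, y), (y, z), (z, x)}"

definition same :: "nat list set" where "same = {[x, y, z]}"
definition reversed :: "nat list set" where "reversed = {[x, z, y]}"
text \<open>Listing the outside point last selects one of the three rotations. In
  \<open>meeting\<close> the point of \<open>{x, y, z}\<close> comes first for the same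
  reason.\<close>

definition along :: "nat list set" where
  "along = {[u, v, w] | u v w. (u, v) \<in> arcs \<and> w \<in> outside}"
definition against :: "nat list set" where
  "against = {[v, u, w] | u v w. (u, v) \<in> arcs \<and> w \<in> outside}"
definition meeting :: "nat list set" where
  "meeting = (\<lambda>(u, ws). u # ws) ` ({x, y, z} \<times> arrangements outside 2)"

lemmas families = same_def reversed_def along_def against_def meeting_def arcs_def

lemma xyz: "x \<noteq> y" "x \<noteq> z" "y \<noteq> z" "x \<in> {1..n}" "y \<in> {1..n}" "z \<in> {1..n}"
  using arr by (auto simp: arrangements_def)

lemma card_outside: "card outside = n - 3"
  using xyz unfolding outside_def by (subst card_Diff_subset) auto

lemma finite_outside [simp]: "finite outside"
  by (simp add: outside_def)

lemma outside_iff: "w \<in> outside \<longleftrightarrow> w \<in> {1..n} \<and> w \<noteq> x \<and> w \<noteq> y \<and> w \<noteq> z"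
  by (auto simp: outside_def)

lemma family_iffs:
  "[p, q, r] \<in> same \<longleftrightarrow> p = x \<and> q = y \<and> r = z"
  "[p, q, r] \<in> reversed \<longleftrightarrow> p = x \<and> q = z \<and> r = y"
  "[p, q, r] \<in> along \<longleftrightarrow> (p, q) \<in> arcs \<and> r \<in> outside"
  "[p, q, r] \<in> against \<longleftrightarrow> (q, p) \<in> arcs \<and> r \<in> outside"
  "[p, q, r] \<in> meeting \<longleftrightarrow> p \<in> {x, y, z} \<and> q \<in> outside \<and> r \<in> outside \<and> q \<noteq> r"
  by (auto simp: same_def reversed_def along_def against_def meeting_def arrangements_2 image_iff)

lemma families_subset:
  "same \<subseteq> arrangements {1..n} 3" "reversed \<subseteq> arrangements {1..n} 3"
  "along \<subseteq> arrangements {1..n} 3" "against \<subseteq> arrangements {1..n} 3"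
  "meeting \<subseteq> arrangements {1..n} 3"
  using xyz by (auto simp: families arrangements_2 arrangements_3 outside_iff)

abbreviation d :: "nat list \<Rightarrow> nat" where
  "d ts \<equiv> hamming_dist n (cycle_of_list ts) (cycle_of_list [x, y, z])"

lemma d_same: "ts \<in> rotations same \<Longrightarrow> d ts = 0"
  by (erule hamming_dist_rotations) (use xyz in \<open>auto simp: families hamming_dist_def\<close>)

lemma d_reversed: "ts \<in> rotations reversed \<Longrightarrow> d ts = 3"
proof (erule hamming_dist_rotations)
  fix us assume "us \<in> reversed"
  then show "distinct us \<and> d us = 3"
    using xyz by (subst hamming_dist_cycles[of "[x, y, z]"]) (auto simp: reversed_def transpose_def)
qed

lemma d_eq:
  assumes "distinct bs" "set bs \<subseteq> {1..n}" "set ts \<union> {x, y, z} \<subseteq> set bs"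
  shows "d ts = moved bs ts [x, y, z]"
  using hamming_dist_cycles[of bs n ts "[x, y, z]"] assms by (simp add: moved_def)

lemma d_along: "ts \<in> rotations along \<Longrightarrow> d ts = 3"
proof (erule hamming_dist_rotations)
  fix us assume "us \<in> along"
  then obtain u v w where us: "us = [u, v, w]" "(u, v) \<in> arcs" "w \<in> outside"
    unfolding along_def by blast
  have bs: "distinct [x, y, z, w]" using xyz us(3) by (auto simp: outside_iff)
  have "d us = moved [x, y, z, w] us [x, y, z]"
    using us xyz by (intro d_eq[OF bs]) (auto simp: arcs_def outside_iff)
  then show "distinct us \<and> d us = 3"
    using moved_along[OF bs] us(1,2) bs unfolding arcs_def by auto
qed

lemma d_against: "ts \<in> rotations against \<Longrightarrow> d ts = 4"
proof (erule hamming_dist_rotations)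
  fix us assume "us \<in> against"
  then obtain u v w where us: "us = [v, u, w]" "(u, v) \<in> arcs" "w \<in> outside"
    unfolding against_def by blast
  have bs: "distinct [x, y, z, w]" using xyz us(3) by (auto simp: outside_iff)
  have "d us = moved [x, y, z, w] us [x, y, z]"
    using us xyz by (intro d_eq[OF bs]) (auto simp: arcs_def outside_iff)
  then show "distinct us \<and> d us = 4"
    using moved_against[OF bs] us(1,2) bs unfolding arcs_def by auto
qed

lemma d_meeting: "ts \<in> rotations meeting \<Longrightarrow> d ts = 5"
proof (erule hamming_dist_rotations)
  fix us assume "us \<in> meeting"
  then obtain u v w where us: "us = [u, v, w]" "u \<in> {x, y, z}" "v \<in> outside" "w \<in> outside" "v \<noteq> w"
    by (auto simp: meeting_def arrangements_2)
  have bs: "distinct [x, y, z, v, w]" using xyz us(3-5) by (auto simp: outside_iff)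
  have "d us = moved [x, y, z, v, w] us [x, y, z]"
    using us xyz by (intro d_eq[OF bs]) (auto simp: outside_iff)
  then show "distinct us \<and> d us = 5"
    using moved_meeting[OF bs] us(1,2) bs by auto
qed

lemma d_disjoint: "ts \<in> arrangements outside 3 \<Longrightarrow> d ts = 6"
proof -
  assume "ts \<in> arrangements outside 3"
  then obtain u v w where ts: "ts = [u, v, w]" "distinct [u, v, w]" "u \<in> outside" "v \<in> outside" "w \<in> outside"
    by (auto simp: arrangements_3)
  have bs: "distinct [x, y, z, u, v, w]" using xyz ts(2-5) by (auto simp: outside_iff)
  have "d ts = moved [x, y, z, u, v, w] ts [x, y, z]"
    using ts(1,3-5) xyz by (intro d_eq[OF bs]) (auto simp: outside_iff)
  then show "d ts = 6"
    using moved_disjoint[OF bs] ts(1) by simp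
qed

text \<open>The number of entries in \<open>{x, y, z}\<close> decides the family, up to orientation:
  any two distinct points of \<open>{x, y, z}\<close> form an arc in exactly one order. The last set
  is already closed under rotation.\<close>

lemma families_cover: "arrangements {1..n} 3 = rotations same \<union> rotations reversed \<union>
    rotations along \<union> rotations against \<union> rotations meeting \<union> arrangements outside 3" (is "_ = ?R")
proof (intro Set.set_eqI iffI)
  fix ts assume "ts \<in> arrangements {1..n} 3"
  then obtain p q r where ts: "ts = [p, q, r]" and pqr: "distinct [p, q, r]"
      "p \<in> {1..n}" "q \<in> {1..n}" "r \<in> {1..n}"
    by (auto simp: arrangements_3)
  have "p \<in> {x, y, z} \<or> p \<in> outside" "q \<in> {x, y, z} \<or> q \<in> outside" "r \<in> {x, y, z} \<or> r \<in> outside"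
    using pqr(2-4) by (auto simp: outside_iff)
  then show "ts \<in> ?R"
    using pqr(1) unfolding ts Un_iff rotations_three_iff arrangements_3 family_iffs
    \<comment> \<open>Each entry is \<open>x\<close>, \<open>y\<close>, \<open>z\<close> or outside,
      giving 64 cases.\<close>
    by (elim disjE insertE emptyE) (simp_all add: arcs_def)
next
  fix ts assume ts: "ts \<in> ?R"
  have "arrangements outside 3 \<subseteq> arrangements {1..n} 3"
    by (auto simp: arrangements_def outside_def)
  then show "ts \<in> arrangements {1..n} 3"
    using ts families_subset[THEN rotations_subset] by blast
qed

text \<open>The distance is constant on each family and the families cover everything, so a level
  set is the union of the families with that value.\<close>

lemma level_sets:
  "{ts \<in> arrangements {1..n} 3. d ts = k} =
    (if k = 0 then rotations same else if k = 3 then rotations reversed \<union> rotations along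
     else if k = 4 then rotations against else if k = 5 then rotations meeting
     else if k = 6 then arrangements outside 3 else {})"
  unfolding families_cover
  by (auto simp: d_same d_reversed d_along d_against d_meeting d_disjoint simp del: cycle_of_list.simps
    dest: d_same d_reversed d_along d_against d_meeting d_disjoint)

section \<open>Sizes of the families\<close>

lemma card_arcs: "card arcs = 3"
  using xyz by (auto simp: arcs_def)

lemma card_rotations_same: "card (rotations same) = 3"
  using xyz by (subst card_rotations[OF _ families_subset(1)]) (auto simp: families)

lemma card_rotations_reversed: "card (rotations reversed) = 3"
  using xyz by (subst card_rotations[OF _ families_subset(2)]) (auto simp: families)

lemma card_rotations_along: "card (rotations along) = 9 * (n - 3)"
proof -
  have along_image: "along = (\<lambda>((u, v), w). [u, v, w]) ` (arcs \<times> outside)"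
    unfolding along_def by (force simp: image_iff)
  have "card along = 3 * (n - 3)"
    unfolding along_image
    by (subst card_image) (auto simp: inj_on_def card_cartesian_product card_arcs card_outside)
  then show ?thesis
    using xyz by (subst card_rotations[OF _ families_subset(3)]) (auto simp: family_iffs arcs_def outside_iff)
qed

lemma card_rotations_against: "card (rotations against) = 9 * (n - 3)"
proof -
  have against_image: "against = (\<lambda>((u, v), w). [v, u, w]) ` (arcs \<times> outside)"
    unfolding against_def by (force simp: image_iff)
  have "card against = 3 * (n - 3)"
    unfolding against_image
    by (subst card_image) (auto simp: inj_on_def card_cartesian_product card_arcs card_outside)
  then show ?thesis
    using xyz by (subst card_rotations[OF _ families_subset(4)]) (auto simp: family_iffs arcs_def outside_iff)
qed

text \<open>Three shared points, times the ordered pairs of outside points, times three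
  rotations.\<close>

lemma card_rotations_meeting: "card (rotations meeting) = 18 * ((n - 3) choose 2)"
proof -
  have "card meeting = 3 * (2 * ((n - 3) choose 2))"
    unfolding meeting_def using xyz
    by (subst card_image) (auto simp: inj_on_def card_cartesian_product card_arrangements card_outside)
  then show ?thesis
    using xyz by (subst card_rotations[OF _ families_subset(5)]) (auto simp: family_iffs outside_iff)
qed

text \<open>These are the only two families at the same distance, so their sizes add up in the count
  for distance 3.\<close>

lemma rotations_reversed_along_disjoint: "rotations reversed \<inter> rotations along = {}"
proof -
  have False if "ts \<in> rotations reversed" "ts \<in> rotations along" for ts
  proof -
    \<comment> \<open>Rotation preserves the set of entries, so \<open>set\<close> is applied to the
      equation for the rotated list.\<close>
    have "set ts = {x, y, z}"
      using that(1) unfolding rotations_def reversed_def by (auto dest!: arg_cong[of _ _ set])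
    moreover have "\<not> set ts \<subseteq> {x, y, z}"
      using that(2) unfolding rotations_def along_def by (auto simp: outside_iff dest!: arg_cong[of _ _ set])
    ultimately show False by blast
  qed
  then show ?thesis by blast
qed

lemma finite_rotations_families: "finite (rotations reversed)" "finite (rotations along)"
  using families_cover finite_arrangements[of "{1..n}" 3] by (metis finite_Un finite_atLeastAtMost)+

text \<open>The coefficients count lists, hence are three times the numbers of 3-cycles; the 6
  before the last binomial is \<open>fact 3\<close>.\<close>

lemma c_three_cycle:
  "c n k (cycle_of_list [x, y, z]) =
    (if k = 0 then 3 else if k = 3 then 3 + 9 * (n - 3) else if k = 4 then 9 * (n - 3)
     else if k = 5 then 18 * ((n - 3) choose 2) else if k = 6 then 6 * ((n - 3) choose 3) else 0)
    * fact (n - 3)"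
  unfolding c_cycle[OF arr] level_sets
  by (simp add: card_rotations_same card_rotations_reversed card_rotations_along
    card_rotations_against card_rotations_meeting card_arrangements card_outside card_Un_disjoint
    finite_rotations_families rotations_reversed_along_disjoint fact_numeral)

end

theorem theorem3p3:
  fixes n :: nat and \<beta>\<^sub>3 :: "nat \<Rightarrow> nat"
  assumes "\<beta>\<^sub>3 \<in> three_cycles n"
  shows "(n \<ge> 3 \<longrightarrow> c n 0 \<beta>\<^sub>3 = 3 * fact (n - 3))
    \<and> (n \<ge> 3 \<longrightarrow> c n 3 \<beta>\<^sub>3 = (3 * (n - 3) + 1) * (3 * fact (n - 3)))
    \<and> (n \<ge> 4 \<longrightarrow> c n 4 \<beta>\<^sub>3 = 3 * (n - 3) * (3 * fact (n - 3)))
    \<and> (n \<ge> 5 \<longrightarrow> c n 5 \<beta>\<^sub>3 = 6 * ((n - 3) choose 2) * (3 * fact (n - 3)))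
    \<and> (n \<ge> 6 \<longrightarrow> c n 6 \<beta>\<^sub>3 = 2 * ((n - 3) choose 3) * (3 * fact (n - 3)))
    \<and> (\<forall>k. 7 \<le> k \<and> k \<le> n \<longrightarrow> c n k \<beta>\<^sub>3 = 0)"
proof -
  \<comment> \<open>Membership in \<open>three_cycles n\<close> provides a distinct list of length 3
    in \<open>{1..n}\<close>, which is what the locale assumes.\<close>
  obtain x y z where "\<beta>\<^sub>3 = cycle_of_list [x, y, z]" "[x, y, z] \<in> arrangements {1..n} 3"
    using assms by (auto simp: arrangements_def numeral_3_eq_3 length_Suc_conv simp del: cycle_of_list.simps)
  then show ?thesis
    using three_cycle.c_three_cycle[of n x y z]
    by (simp add: three_cycle_def algebra_simps del: cycle_of_list.simps)
qed

end
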